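(* Let $G$ and $H$ be finite graphs such that $G$ is connected and $|V(G)|=|V(H)|\geq 2$. Then $$h^+_{H}(G)\leq h^+_{H}(P_{|V(G)|-1}).$$
   Context: All graphs are finite, simple and undirected. $P_{n-1}$ denotes the path of length $n-1$ (so it has $n$ vertices). For a connected graph $G$, $\rho_G(x,y)$ denotes the graph distance of vertices $x,y$ in $G$. Given graphs $G,H$ with $|V(G)|=|V(H)|$, a pseudoordering on $G$ by $H$ is a bijection $f:V(H)\to V(G)$, and its sum is $$s_H(f,G)=\sum_{\{x,y\}\in E(H)}\rho_G(f(x),f(y)).$$ The upper $H$-Hamiltonian number of $G$ is $h_H^+(G)=\max\{s_H(f,G)\mid f \text{ a pseudoordering on } G \text{ by } H\}$. *)

theory Defs
  imports "Graph_Theory.Graph_Theory"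
begin

text \<open>
  Finite simple undirected graphs are the \<^locale>\<open>pair_graph\<close>s: finite, loop-free, symmetric
  digraphs whose arcs are ordered pairs of vertices.  An undirected edge \<open>{x, y}\<close> is thus present as
  the two arcs \<open>(x, y)\<close> and \<open>(y, x)\<close>, and is recovered as a two-element set by \<open>uedges\<close>.
\<close>

definition uedges :: "'a pair_pre_digraph \<Rightarrow> 'a set set" where
  "uedges G = {{x, y} | x y. (x, y) \<in> parcs G}"

text \<open>Meaningful when \<open>y\<close> is reachable from \<open>x\<close>, in particular in a connected graph.\<close>

definition graph_dist :: "'a pair_pre_digraph \<Rightarrow> 'a \<Rightarrow> 'a \<Rightarrow> nat" where
  "graph_dist G x y = (LEAST n. \<exists>p. pre_digraph.awalk (with_proj G) x p y \<and> length p = n)"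

definition path_graph :: "nat \<Rightarrow> nat pair_pre_digraph" where
  "path_graph n = \<lparr> pverts = {0..n},
     parcs = {(i, j). i \<le> n \<and> j \<le> n \<and> (j = Suc i \<or> i = Suc j)} \<rparr>"

definition pseudoordering ::
  "'b pair_pre_digraph \<Rightarrow> ('b \<Rightarrow> 'a) \<Rightarrow> 'a pair_pre_digraph \<Rightarrow> bool" where
  "pseudoordering H f G \<longleftrightarrow> bij_betw f (pverts H) (pverts G)"

text \<open>
  The summand of \<open>{x, y}\<close> does not depend on the order of the two end vertices when \<open>G\<close> is undirected
  (see \<open>edge_summand\<close> below), so the set under \<^const>\<open>the_elem\<close> is a singleton.
\<close>

definition pseudo_sum ::
  "'b pair_pre_digraph \<Rightarrow> ('b \<Rightarrow> 'a) \<Rightarrow> 'a pair_pre_digraph \<Rightarrow> nat" where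
  "pseudo_sum H f G =
     (\<Sum>e\<in>uedges H. the_elem {graph_dist G (f x) (f y) | x y. e = {x, y}})"

definition upper_hamiltonian_number ::
  "'b pair_pre_digraph \<Rightarrow> 'a pair_pre_digraph \<Rightarrow> nat" where
  "upper_hamiltonian_number H G = Max {pseudo_sum H f G | f. pseudoordering H f G}"


lemma pair_graph_path_graph: "pair_graph (path_graph n)"
proof
  show "finite (parcs (path_graph n))"
    by (rule finite_subset[of _ "{0..n} \<times> {0..n}"]) (auto simp: path_graph_def)
qed (auto simp: path_graph_def symmetric_def arcs_ends_def arc_to_ends_def with_proj_def sym_def)

lemma card_path_graph: "card (pverts (path_graph n)) = Suc n"
  by (simp add: path_graph_def)

lemma awalk_rev:
  assumes "pair_graph G" "pre_digraph.awalk (with_proj G) x p y"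
  shows "\<exists>q. pre_digraph.awalk (with_proj G) y q x \<and> length q = length p"
proof -
  interpret pair_graph G by fact
  show ?thesis using assms(2)
  proof (induction p arbitrary: x)
    case Nil
    then show ?case by (auto simp: awalk_Nil_iff)
  next
    case (Cons e es)
    obtain a b where e: "e = (a, b)" by fastforce
    from Cons.prems have w: "x = a" "(a, b) \<in> parcs G" "awalk b es y"
      by (auto simp: awalk_Cons_iff e)
    from Cons.IH[OF w(3)] obtain q where q: "awalk y q b" "length q = length es" by blast
    have "(b, a) \<in> parcs G" using w(2) by (rule arcs_symmetric)
    then have "awalk b [(b, a)] a" by (intro arc_implies_awalk[of "(b, a)", simplified])
    with q have "awalk y (q @ [(b, a)]) x" using w(1) by auto
    then show ?case using q(2) by (intro exI[of _ "q @ [(b, a)]"]) simp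
  qed
qed

lemma graph_dist_sym:
  assumes "pair_graph G"
  shows "graph_dist G x y = graph_dist G y x"
proof -
  have "(\<exists>p. pre_digraph.awalk (with_proj G) x p y \<and> length p = n) \<longleftrightarrow>
        (\<exists>p. pre_digraph.awalk (with_proj G) y p x \<and> length p = n)" for n
    using awalk_rev[OF assms] by metis
  then show ?thesis by (simp add: graph_dist_def)
qed

lemma edge_summand:
  assumes "pair_graph G"
  shows "the_elem {graph_dist G (f x) (f y) | x y. {a, b} = {x, y}} = graph_dist G (f a) (f b)"
proof -
  have "{graph_dist G (f x) (f y) | x y. {a, b} = {x, y}} = {graph_dist G (f a) (f b)}"
    using graph_dist_sym[OF assms] by (fastforce simp: doubleton_eq_iff)
  then show ?thesis by simp
qed

lemma graph_dist_eq_shortest_path: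
  assumes "pair_graph G" "connected (with_proj G)" "x \<in> pverts G" "y \<in> pverts G"
  shows "ereal (real (graph_dist G x y)) = wf_digraph.\<mu> (with_proj G) (\<lambda>_. 1) x y"
proof -
  interpret pair_graph G by fact
  have cost: "awalk_cost (\<lambda>_. 1) p = real (length p)" for p
    by (induction p) auto
  have "x \<rightarrow>\<^sup>*\<^bsub>with_proj G\<^esub> y"
    using assms symmetric_connected_imp_strongly_connected[OF pair_sym_arcs]
    by (auto elim: strongly_connectedE)
  then have ex: "\<exists>n p. awalk x p y \<and> length p = n"
    by (auto simp: reachable_awalk)
  then obtain p where p: "awalk x p y" "length p = graph_dist G x y"
    unfolding graph_dist_def using LeastI_ex[OF ex] by blast
  have least: "graph_dist G x y \<le> length q" if "awalk x q y" for q
    unfolding graph_dist_def using that by (auto intro: Least_le)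
  show ?thesis
    unfolding \<mu>_def cost
    by (rule antisym) (use p least in \<open>auto intro!: INF_greatest INF_lower2[of p]\<close>)
qed

text \<open>The maximum in \<^const>\<open>upper_hamiltonian_number\<close> ranges over a finite nonempty set.\<close>

lemma pseudo_sums_finite_nonempty:
  assumes "pair_graph G" "pair_graph H" "card (pverts G) = card (pverts H)"
  shows "finite {pseudo_sum H f G | f. pseudoordering H f G}"
    and "{pseudo_sum H f G | f. pseudoordering H f G} \<noteq> {}"
proof -
  interpret G: pair_graph G by fact
  interpret H: pair_graph H by fact
  have restr: "pseudo_sum H f G = pseudo_sum H (restrict f (pverts H)) G" for f
    unfolding pseudo_sum_def
  proof (rule sum.cong[OF refl])
    fix e assume "e \<in> uedges H"
    then obtain a b where e: "e = {a, b}" "(a, b) \<in> parcs H" by (auto simp: uedges_def)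
    then have "a \<in> pverts H" "b \<in> pverts H"
      using H.arc_fst_in_verts H.arc_snd_in_verts by fastforce+
    then show "the_elem {graph_dist G (f x) (f y) | x y. e = {x, y}} =
      the_elem {graph_dist G (restrict f (pverts H) x) (restrict f (pverts H) y) | x y. e = {x, y}}"
      by (simp only: e edge_summand[OF assms(1)] restrict_apply' if_True)
  qed
  have "{pseudo_sum H f G | f. pseudoordering H f G}
      \<subseteq> (\<lambda>f. pseudo_sum H f G) ` (pverts H \<rightarrow>\<^sub>E pverts G)"
  proof
    fix s assume "s \<in> {pseudo_sum H f G | f. pseudoordering H f G}"
    then obtain f where f: "s = pseudo_sum H f G" "bij_betw f (pverts H) (pverts G)"
      by (auto simp: pseudoordering_def)
    then have "restrict f (pverts H) \<in> pverts H \<rightarrow>\<^sub>E pverts G"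
      by (auto simp: bij_betw_def)
    then show "s \<in> (\<lambda>f. pseudo_sum H f G) ` (pverts H \<rightarrow>\<^sub>E pverts G)"
      using f(1) restr[of f] by blast
  qed
  then show "finite {pseudo_sum H f G | f. pseudoordering H f G}"
    by (rule finite_subset) (simp add: finite_PiE)
  show "{pseudo_sum H f G | f. pseudoordering H f G} \<noteq> {}"
    using finite_same_card_bij[OF H.pair_finite_verts G.pair_finite_verts assms(3)[symmetric]]
    by (auto simp: pseudoordering_def)
qed

end

theory Submission
  imports Defs
begin

text \<open>
  Identify \<open>V(H)\<close> with \<open>V(G)\<close> along a pseudoordering, so that the edges of \<open>H\<close> become weights on pairs
  of vertices of \<open>G\<close>.  It then suffices to lay out the vertices of \<open>G\<close> on a line such that the
  weighted sum of distances does not decrease (\<open>exists_line_ordering\<close>).  Single distances may shrink;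
  only the sum is controlled.

  The line is built one vertex at a time, from the left.  The unplaced vertices induce a
  connected graph.  The part of the line already built is attached to this graph by an edge at one
  vertex \<open>u\<close>, and its weight towards an unplaced vertex \<open>x\<close> is \<open>c x\<close>.  This weight contributes
  \<open>c x\<close> times the distance between \<open>x\<close> and \<open>u\<close>, up to a term that does not depend on \<open>u\<close>.  So the
  point of attachment may be moved from \<open>u\<close> to any \<open>v\<close> at which the sum \<open>g\<close> of these contributions
  is at least as large.  If \<open>v\<close> is not a cut vertex, \<open>v\<close> can be placed next on the line: the remaining
  graph is connected and hangs at \<open>v\<close> by one edge, so the situation is the same with
  one vertex fewer.

  A suitable \<open>v\<close> exists because \<open>g\<close> is convex at cut vertices
  (\<open>non_cut_vertex_of_large_distance_sum\<close>): if \<open>a\<close> and \<open>b\<close> are neighbours of \<open>v\<close> on different sides of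
  the cut at \<open>v\<close>, every vertex is farther from one of them than from \<open>v\<close>, and nearer to the other by at
  most one, whence \<open>g a + g b \<ge> 2 g v\<close>.  So a cut vertex maximizes \<open>g\<close> only together with \<open>a\<close> and \<open>b\<close>, and
  a maximizer at the greatest distance from a fixed vertex is not a cut vertex.
\<close>

section \<open>Distances in a relation\<close>

definition rel_dist :: "'a rel \<Rightarrow> 'a \<Rightarrow> 'a \<Rightarrow> nat" where
  "rel_dist R x y = (LEAST n. (x, y) \<in> R ^^ n)"

text \<open>
  The vertices are removed one by one from a fixed graph, so connectedness is expressed for the
  subgraph induced by a vertex set.
\<close>

definition connected_on :: "'a rel \<Rightarrow> 'a set \<Rightarrow> bool" where
  "connected_on E S \<longleftrightarrow> (\<forall>x\<in>S. \<forall>y\<in>S. (x, y) \<in> (Restr E S)\<^sup>*)"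

lemma rel_dist_le: "(x, y) \<in> R ^^ n \<Longrightarrow> rel_dist R x y \<le> n"
  by (simp add: rel_dist_def Least_le)

lemma relpow_rel_dist: "(x, y) \<in> R\<^sup>* \<Longrightarrow> (x, y) \<in> R ^^ rel_dist R x y"
  unfolding rel_dist_def by (metis LeastI_ex rtrancl_imp_relpow)

lemma rel_dist_self [simp]: "rel_dist R x x = 0"
  by (simp add: rel_dist_def Least_eq_0)

lemma rel_dist_step:
  assumes "(x, y) \<in> R\<^sup>*" "(y, z) \<in> R"
  shows "rel_dist R x z \<le> Suc (rel_dist R x y)"
  by (rule rel_dist_le) (use relpow_rel_dist[OF assms(1)] assms(2) in auto)

lemma rel_dist_antimono:
  assumes "R' \<subseteq> R" "(x, y) \<in> R'\<^sup>*"
  shows "rel_dist R x y \<le> rel_dist R' x y"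
proof (rule rel_dist_le)
  have "(x, z) \<in> R ^^ n" if "(x, z) \<in> R' ^^ n" for n z
    using that assms(1) by (induction n arbitrary: z) auto
  then show "(x, y) \<in> R ^^ rel_dist R' x y"
    using relpow_rel_dist[OF assms(2)] by blast
qed

lemma rel_dist_sym:
  assumes "sym R"
  shows "rel_dist R x y = rel_dist R y x"
proof -
  have "(b, a) \<in> R ^^ n" if "(a, b) \<in> R ^^ n" for a b n
    using that
  proof (induction n arbitrary: b)
    case (Suc n)
    then obtain z where "(a, z) \<in> R ^^ n" "(z, b) \<in> R" by auto
    with Suc.IH assms show ?case by (meson relpow_Suc_I2 symD)
  qed simp
  then have "(x, y) \<in> R ^^ n \<longleftrightarrow> (y, x) \<in> R ^^ n" for n by blast
  then show ?thesis by (simp add: rel_dist_def)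
qed

text \<open>
  A walk that ends in \<open>B\<close> but starts outside has to enter \<open>B\<close> through \<open>u\<close>, so its part up to \<open>u\<close> is
  strictly shorter.
\<close>

lemma rel_dist_beyond_separator:
  assumes into: "\<And>y z. (z, y) \<in> R \<Longrightarrow> y \<in> B \<Longrightarrow> z \<notin> B \<Longrightarrow> z = u"
    and "x \<notin> B" "b \<in> B" "(x, b) \<in> R\<^sup>*"
  shows "rel_dist R x u < rel_dist R x b"
proof -
  have "\<exists>m<n. (x, u) \<in> R ^^ m" if "(x, y) \<in> R ^^ n" "y \<in> B" for n y
    using that
  proof (induction n arbitrary: y)
    case 0
    with \<open>x \<notin> B\<close> show ?case by simp
  next
    case (Suc n)
    then obtain z where z: "(x, z) \<in> R ^^ n" "(z, y) \<in> R" by auto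
    show ?case
    proof (cases "z \<in> B")
      case True
      with Suc.IH z(1) show ?thesis using less_SucI by blast
    next
      case False
      with into z Suc.prems(2) show ?thesis by blast
    qed
  qed
  from this[OF relpow_rel_dist[OF assms(4)] assms(3)] show ?thesis
    using rel_dist_le by (metis le_less_trans)
qed

lemma rtrancl_enters:
  assumes "(x, y) \<in> R\<^sup>*" "x \<notin> B" "y \<in> B"
  shows "\<exists>z b. (z, b) \<in> R \<and> z \<notin> B \<and> b \<in> B"
  using assms by (induction rule: rtrancl_induct) blast+

section \<open>Weighted distance sums are maximal at a non-cut vertex\<close>

text \<open>
  \<open>B\<close> is a connected component.  As there are at least two components, one of them avoids the
  prescribed vertex \<open>r\<close>; this choice breaks the tie in the next lemma.
\<close>

lemma not_connected_on_imp_separation: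
  assumes "sym E" "\<not> connected_on E S"
  obtains A B where "A \<union> B = S" "A \<inter> B = {}" "A \<noteq> {}" "B \<noteq> {}" "r \<notin> B"
    "\<And>a b. a \<in> A \<Longrightarrow> b \<in> B \<Longrightarrow> (a, b) \<notin> E \<and> (b, a) \<notin> E"
proof -
  let ?R = "Restr E S"
  have symR: "sym ?R" using assms(1) by (auto simp: sym_def)
  from assms(2) obtain x y where xy: "x \<in> S" "y \<in> S" "(x, y) \<notin> ?R\<^sup>*"
    by (auto simp: connected_on_def)
  have symRs: "(b, a) \<in> ?R\<^sup>*" if "(a, b) \<in> ?R\<^sup>*" for a b
    using that symR by (meson sym_rtrancl symD)
  \<comment> \<open>\<open>s\<close> lies in a component without \<open>r\<close>, and \<open>t\<close> outside this component.\<close>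
  obtain s t where st: "s \<in> S" "t \<in> S" "(s, t) \<notin> ?R\<^sup>*" "(s, r) \<notin> ?R\<^sup>*"
  proof (cases "(x, r) \<in> ?R\<^sup>*")
    case True
    then have "(y, r) \<notin> ?R\<^sup>*" "(y, x) \<notin> ?R\<^sup>*" using xy(3) symRs rtrancl_trans by metis+
    with that xy show ?thesis by blast
  next
    case False
    with that xy show ?thesis by blast
  qed
  define B where "B = {z \<in> S. (s, z) \<in> ?R\<^sup>*}"
  have sep: "(b, a) \<notin> E" if "a \<in> S - B" "b \<in> B" for a b
  proof
    assume "(b, a) \<in> E"
    then have "(s, a) \<in> ?R\<^sup>*"
      using that by (auto simp: B_def intro: rtrancl_into_rtrancl)
    then show False using that by (simp add: B_def)
  qed
  show thesis
  proof (rule that[of "S - B" B])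
    show "(a, b) \<notin> E \<and> (b, a) \<notin> E" if "a \<in> S - B" "b \<in> B" for a b
      using sep[OF that] assms(1) by (meson symD)
  qed (use st in \<open>auto simp: B_def\<close>)
qed

text \<open>
  Convexity alone shows only that a maximizer \<open>v\<close> of the distance sum \<open>g\<close> which is a cut vertex has
  neighbours on both sides that are maximizers as well.  Hence \<open>v\<close> is chosen among the maximizers as far
  away from \<open>u\<close> as possible: a neighbour of \<open>v\<close> on a side that does not contain \<open>u\<close> is farther from \<open>u\<close>
  than \<open>v\<close>, so it cannot be a maximizer too.
\<close>

lemma non_cut_vertex_of_large_distance_sum:
  fixes c :: "'a \<Rightarrow> nat"
  assumes fin: "finite S" and symE: "sym E" and conn: "connected_on E S" and u: "u \<in> S"
  shows "\<exists>v\<in>S. connected_on E (S - {v}) \<and>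
    (\<Sum>x\<in>S. c x * rel_dist (Restr E S) x u) \<le> (\<Sum>x\<in>S. c x * rel_dist (Restr E S) x v)"
proof -
  let ?R = "Restr E S"
  let ?d = "rel_dist ?R"
  define g where "g z = (\<Sum>x\<in>S. c x * ?d x z)" for z
  have symR: "sym ?R" using symE by (auto simp: sym_def)
  have reach: "(x, y) \<in> ?R\<^sup>*" if "x \<in> S" "y \<in> S" for x y
    using conn that by (simp add: connected_on_def)
  define M where "M = {z \<in> S. \<forall>y\<in>S. g y \<le> g z}"
  have "Max (g ` S) \<in> g ` S" using fin u by (intro Max_in) auto
  then obtain z where "z \<in> S" "g z = Max (g ` S)" by auto
  then have "z \<in> M" using fin by (auto simp: M_def)
  then have M: "finite M" "M \<noteq> {}" using fin by (auto simp: M_def)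
  have "Max (?d u ` M) \<in> ?d u ` M" using M by (intro Max_in) auto
  then obtain v where v: "v \<in> M" "?d u v = Max (?d u ` M)" by auto
  then have far: "?d u y \<le> ?d u v" if "y \<in> M" for y
    using M that by auto
  have vS: "v \<in> S" and vmax: "g y \<le> g v" if "y \<in> S" for y
    using v that by (auto simp: M_def)
  have "connected_on E (S - {v})"
  proof (rule ccontr)
    assume "\<not> connected_on E (S - {v})"
    then obtain A B where AB: "A \<union> B = S - {v}" "A \<inter> B = {}" "A \<noteq> {}" "B \<noteq> {}" "u \<notin> B"
      and sep: "\<And>a b. a \<in> A \<Longrightarrow> b \<in> B \<Longrightarrow> (a, b) \<notin> E \<and> (b, a) \<notin> E"
      using not_connected_on_imp_separation[OF symE, of "S - {v}" u] by metis
    have intoA: "z = v" if "(z, y) \<in> ?R" "y \<in> A" "z \<notin> A" for y z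
      using that sep[of y z] AB(1) by blast
    have intoB: "z = v" if "(z, y) \<in> ?R" "y \<in> B" "z \<notin> B" for y z
      using that sep[of z y] AB(1) by blast
    have vAB: "v \<in> S" "v \<notin> A" "v \<notin> B" using AB(1) v by (auto simp: M_def)
    obtain a where a: "a \<in> A" "(v, a) \<in> ?R"
    proof -
      obtain a0 where "a0 \<in> A" "a0 \<in> S" using AB by blast
      from rtrancl_enters[OF reach[OF vAB(1) this(2)] vAB(2) this(1)] intoA that
      show ?thesis by blast
    qed
    obtain b where b: "b \<in> B" "(v, b) \<in> ?R"
    proof -
      obtain b0 where "b0 \<in> B" "b0 \<in> S" using AB by blast
      from rtrancl_enters[OF reach[OF vAB(1) this(2)] vAB(3) this(1)] intoB that
      show ?thesis by blast
    qed
    have abS: "a \<in> S" "b \<in> S" using a b by auto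
    have near: "?d x v \<le> Suc (?d x a)" "?d x v \<le> Suc (?d x b)" if "x \<in> S" for x
      using rel_dist_step[OF reach[OF that]] a(2) b(2) abS symR by (meson symD)+
    have convex: "2 * ?d x v \<le> ?d x a + ?d x b" if x: "x \<in> S" for x
    proof (cases "x \<in> B")
      case True
      then have "x \<notin> A" using AB(2) by blast
      then have "?d x v < ?d x a"
        using rel_dist_beyond_separator[of ?R A v x a] intoA a(1) reach[OF x abS(1)] by blast
      with near(2)[OF x] show ?thesis by simp
    next
      case False
      then have "?d x v < ?d x b"
        using rel_dist_beyond_separator[of ?R B v x b] intoB b(1) reach[OF x abS(2)] by blast
      with near(1)[OF x] show ?thesis by simp
    qed
    have "2 * g v = (\<Sum>x\<in>S. c x * (2 * ?d x v))"
      by (simp add: g_def sum_distrib_left mult_ac)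
    also have "\<dots> \<le> (\<Sum>x\<in>S. c x * (?d x a + ?d x b))"
      using convex by (intro sum_mono mult_le_mono2)
    also have "\<dots> = g a + g b"
      by (simp add: g_def sum.distrib distrib_left)
    finally have "g b = g v"
      using vmax[OF abS(1)] vmax[OF abS(2)] by linarith
    then have "b \<in> M" using abS(2) vmax by (simp add: M_def)
    then have "?d u b \<le> ?d u v" by (rule far)
    moreover have "?d u v < ?d u b"
      using rel_dist_beyond_separator[of ?R B v u b] intoB b(1) reach[OF u abS(2)] AB(5) by blast
    ultimately show False by simp
  qed
  then show ?thesis using v(1) u by (auto simp: M_def g_def)
qed

section \<open>Unfolding a connected graph to a line\<close>

definition line_dist :: "nat \<Rightarrow> nat \<Rightarrow> nat" where
  "line_dist i j = (i - j) + (j - i)"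

lemma sum_pairs_insert:
  fixes w :: "'a \<Rightarrow> 'a \<Rightarrow> nat"
  assumes "finite T" "v \<notin> T" "F v v = 0" "\<And>x. x \<in> T \<Longrightarrow> F v x = F x v"
  shows "(\<Sum>x\<in>insert v T. \<Sum>y\<in>insert v T. w x y * F x y) =
    (\<Sum>x\<in>T. \<Sum>y\<in>T. w x y * F x y) + (\<Sum>x\<in>T. (w v x + w x v) * F x v)"
  using assms by (simp add: sum.distrib distrib_right)

text \<open>
  Position \<open>0\<close> of the line stands for the last vertex placed before \<open>S\<close>; it is joined to \<open>u\<close> by an edge,
  which accounts for the \<open>Suc\<close> on the left and for the positions starting at \<open>1\<close>.  When \<open>v\<close> is placed, its
  weights towards the remaining vertices join the outside weight.  A single outside weight suffices
  because a vertex \<open>k\<close> positions before \<open>v\<close> is farther than \<open>v\<close>, by exactly \<open>k\<close>, from every vertex placed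
  later.
\<close>

lemma exists_line_ordering:
  fixes w :: "'a \<Rightarrow> 'a \<Rightarrow> nat" and c :: "'a \<Rightarrow> nat"
  assumes "finite S" "sym E" "connected_on E S" "u \<in> S"
  shows "\<exists>p. bij_betw p S {1..card S} \<and>
    (\<Sum>x\<in>S. \<Sum>y\<in>S. w x y * rel_dist (Restr E S) x y)
      + (\<Sum>x\<in>S. c x * Suc (rel_dist (Restr E S) x u))
    \<le> (\<Sum>x\<in>S. \<Sum>y\<in>S. w x y * line_dist (p x) (p y)) + (\<Sum>x\<in>S. c x * p x)"
  using assms
proof (induction "card S" arbitrary: S u c)
  case 0
  then show ?case by simp
next
  case (Suc n)
  let ?R = "Restr E S"
  let ?d = "rel_dist ?R"
  obtain v where v: "v \<in> S" "connected_on E (S - {v})"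
    "(\<Sum>x\<in>S. c x * ?d x u) \<le> (\<Sum>x\<in>S. c x * ?d x v)"
    using non_cut_vertex_of_large_distance_sum[OF Suc.prems] by blast
  have root: "(\<Sum>x\<in>S. c x * Suc (?d x u)) \<le> (\<Sum>x\<in>S. c x * Suc (?d x v))"
    using v(3) by (simp add: sum.distrib)
  define T where "T = S - {v}"
  have T: "S = insert v T" "v \<notin> T" "finite T" "card T = n"
    using v(1) Suc by (auto simp: T_def)
  have symR: "sym ?R" using Suc.prems(2) by (auto simp: sym_def)
  show ?case
  proof (cases "T = {}")
    case True
    then have "S = {v}" using T by simp
    then show ?thesis using Suc.prems(4)
      by (intro exI[of _ "\<lambda>_. 1"]) (auto simp: line_dist_def bij_betw_def)
  next
    case False
    let ?e = "rel_dist (Restr E T)"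
    \<comment> \<open>The remaining graph is attached to \<open>v\<close> by the edge at \<open>t\<close> only.  Deleting the other edges at
      \<open>v\<close> can only increase distances.\<close>
    obtain t where t: "t \<in> T" "(t, v) \<in> ?R"
    proof -
      obtain t0 where "t0 \<in> T" using False by blast
      then have "(v, t0) \<in> ?R\<^sup>*" using Suc.prems(3) T(1) by (simp add: connected_on_def)
      from rtrancl_enters[OF this T(2) \<open>t0 \<in> T\<close>] obtain z t where
        "(z, t) \<in> ?R" "z \<notin> T" "t \<in> T" by blast
      moreover from this have "z = v" using T(1) by blast
      ultimately show ?thesis using that symR by (meson symD)
    qed
    have sub: "Restr E T \<subseteq> ?R" using T(1) by blast
    have reachT: "(x, y) \<in> (Restr E T)\<^sup>*" if "x \<in> T" "y \<in> T" for x y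
      using v(2) that by (simp add: connected_on_def T_def)
    have dT: "?d x y \<le> ?e x y" if "x \<in> T" "y \<in> T" for x y
      using rel_dist_antimono[OF sub reachT[OF that]] .
    have dv: "?d x v \<le> Suc (?e x t)" if "x \<in> T" for x
      using rel_dist_step[OF subsetD[OF rtrancl_mono[OF sub] reachT[OF that t(1)]] t(2)]
        dT[OF that t(1)] by linarith
    \<comment> \<open>From now on \<open>v\<close> belongs to the outside and plays the part of position \<open>0\<close>.\<close>
    define c' where "c' x = c x + (w v x + w x v)" for x
    obtain q where q: "bij_betw q T {1..n}"
      "(\<Sum>x\<in>T. \<Sum>y\<in>T. w x y * ?e x y) + (\<Sum>x\<in>T. c' x * Suc (?e x t))
        \<le> (\<Sum>x\<in>T. \<Sum>y\<in>T. w x y * line_dist (q x) (q y)) + (\<Sum>x\<in>T. c' x * q x)"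
      using Suc.hyps(1)[of T t c'] T(3,4) Suc.prems(2) v(2) t(1) by (auto simp: T_def)
    define p where "p x = (if x = v then 1 else Suc (q x))" for x
    have pT: "p x = Suc (q x)" if "x \<in> T" for x using that T(2) by (auto simp: p_def)
    have q0: "1 \<le> q x" if "x \<in> T" for x using q(1) that by (auto simp: bij_betw_def)
    have bij: "bij_betw p S {1..card S}"
    proof -
      have "bij_betw (Suc \<circ> q) T {2..Suc n}"
        using bij_betw_trans[OF q(1), of Suc "{2..Suc n}"]
        by (simp add: bij_betw_def numeral_2_eq_2)
      then have "bij_betw p T {2..Suc n}"
        using bij_betw_cong[of T p "Suc \<circ> q"] pT by simp
      then have "bij_betw p (insert v T) (insert (p v) {2..Suc n})"
        using T(2) by (subst notIn_Un_bij_betw3[symmetric, of v T p "{2..Suc n}", simplified])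
          (auto simp: p_def)
      moreover have "insert (p v) {2..Suc n} = {1..card S}"
        using Suc.hyps(2) by (auto simp: p_def)
      ultimately show ?thesis using T(1) by simp
    qed
    have "(\<Sum>x\<in>S. \<Sum>y\<in>S. w x y * ?d x y) + (\<Sum>x\<in>S. c x * Suc (?d x u))
      \<le> (\<Sum>x\<in>S. \<Sum>y\<in>S. w x y * ?d x y) + (\<Sum>x\<in>S. c x * Suc (?d x v))"
      using root by simp
    also have "\<dots> = (\<Sum>x\<in>T. \<Sum>y\<in>T. w x y * ?d x y) + (\<Sum>x\<in>T. c' x * ?d x v)
        + (\<Sum>x\<in>T. c x) + c v"
    proof -
      have "(\<Sum>x\<in>S. \<Sum>y\<in>S. w x y * ?d x y) = (\<Sum>x\<in>T. \<Sum>y\<in>T. w x y * ?d x y)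
          + (\<Sum>x\<in>T. (w v x + w x v) * ?d x v)"
        using sum_pairs_insert[of T v ?d w] T rel_dist_sym[OF symR, of v] by simp
      moreover have "(\<Sum>x\<in>S. c x * Suc (?d x v)) = (\<Sum>x\<in>T. c x * ?d x v) + (\<Sum>x\<in>T. c x) + c v"
        using T by (simp add: sum.distrib)
      ultimately show ?thesis by (simp add: c'_def sum.distrib distrib_right)
    qed
    also have "\<dots> \<le> (\<Sum>x\<in>T. \<Sum>y\<in>T. w x y * ?e x y) + (\<Sum>x\<in>T. c' x * Suc (?e x t))
        + (\<Sum>x\<in>T. c x) + c v"
      using dT dv by (intro add_mono sum_mono mult_le_mono order_refl)
    also have "\<dots> \<le> (\<Sum>x\<in>T. \<Sum>y\<in>T. w x y * line_dist (q x) (q y)) + (\<Sum>x\<in>T. c' x * q x)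
        + (\<Sum>x\<in>T. c x) + c v"
      using q(2) by simp
    also have "\<dots> = (\<Sum>x\<in>S. \<Sum>y\<in>S. w x y * line_dist (p x) (p y)) + (\<Sum>x\<in>S. c x * p x)"
    proof -
      have "(\<Sum>x\<in>S. \<Sum>y\<in>S. w x y * line_dist (p x) (p y)) =
          (\<Sum>x\<in>T. \<Sum>y\<in>T. w x y * line_dist (p x) (p y))
          + (\<Sum>x\<in>T. (w v x + w x v) * line_dist (p x) (p v))"
        using sum_pairs_insert[of T v "\<lambda>x y. line_dist (p x) (p y)" w] T
        by (simp add: line_dist_def)
      also have "\<dots> = (\<Sum>x\<in>T. \<Sum>y\<in>T. w x y * line_dist (q x) (q y))
          + (\<Sum>x\<in>T. (w v x + w x v) * q x)"
        using q0 by (simp add: pT) (simp add: line_dist_def p_def)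
      finally have 1: "(\<Sum>x\<in>S. \<Sum>y\<in>S. w x y * line_dist (p x) (p y)) = \<dots>" .
      have "(\<Sum>x\<in>S. c x * p x) = (\<Sum>x\<in>T. c x * q x) + (\<Sum>x\<in>T. c x) + c v"
        using T by (simp add: pT sum.distrib) (simp add: p_def)
      with 1 show ?thesis by (simp add: c'_def sum.distrib distrib_right)
    qed
    finally show ?thesis using bij by blast
  qed
qed

section \<open>Graph distances and sums over arcs\<close>

lemma pair_graphD:
  assumes "pair_graph G"
  shows "finite (pverts G)" "finite (parcs G)" "parcs G \<subseteq> pverts G \<times> pverts G"
    "sym (parcs G)" "(x, y) \<in> parcs G \<Longrightarrow> x \<noteq> y" "wf_digraph (with_proj G)"
proof -
  have fin: "pair_fin_digraph G" and symG: "pair_sym_digraph G"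
    using pair_pseudo_graph.axioms[OF pair_graph.axioms(2)[OF assms]] .
  have lf: "pair_loopfree_digraph G"
    using pair_digraph.axioms(2)[OF pair_graph.axioms(1)[OF assms]] .
  have wf: "pair_wf_digraph G" using pair_fin_digraph.axioms(1)[OF fin] .
  show "finite (pverts G)" by (rule pair_fin_digraph.pair_finite_verts[OF fin])
  show "finite (parcs G)" by (rule pair_fin_digraph.pair_finite_arcs[OF fin])
  show "parcs G \<subseteq> pverts G \<times> pverts G"
    using pair_wf_digraph.in_arcsD1[OF wf] pair_wf_digraph.in_arcsD2[OF wf] by auto
  show "sym (parcs G)"
    using pair_sym_digraph.pair_sym_arcs[OF symG] by (simp add: symmetric_def)
  show "x \<noteq> y" if "(x, y) \<in> parcs G"
    by (rule pair_loopfree_digraph.no_loops'[OF lf that])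
  show "wf_digraph (with_proj G)" using wf by (simp add: wf_digraph_wp_iff)
qed

text \<open>
  The start has to be a vertex, because \<open>R ^^ 0\<close> is the identity on the whole type.
\<close>

lemma awalk_iff_relpow:
  assumes "pair_graph G" "x \<in> pverts G"
  shows "(\<exists>p. pre_digraph.awalk (with_proj G) x p y \<and> length p = n) \<longleftrightarrow> (x, y) \<in> parcs G ^^ n"
  using assms(2)
proof (induction n arbitrary: x)
  case 0
  then show ?case
    by (simp add: wf_digraph.awalk_Nil_iff[OF pair_graphD(6)[OF assms(1)]])
next
  case (Suc n)
  let ?walk = "pre_digraph.awalk (with_proj G)"
  have Cons: "?walk x (e # p) y \<longleftrightarrow> e \<in> parcs G \<and> x = fst e \<and> ?walk (snd e) p y" for e p
    by (simp add: wf_digraph.awalk_Cons_iff[OF pair_graphD(6)[OF assms(1)]])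
  have "(\<exists>p. ?walk x p y \<and> length p = Suc n) \<longleftrightarrow>
      (\<exists>z. (x, z) \<in> parcs G \<and> (\<exists>p. ?walk z p y \<and> length p = n))"
  proof
    assume "\<exists>p. ?walk x p y \<and> length p = Suc n"
    then obtain e p where "?walk x (e # p) y" "length p = n" by (metis length_Suc_conv)
    then show "\<exists>z. (x, z) \<in> parcs G \<and> (\<exists>p. ?walk z p y \<and> length p = n)"
      unfolding Cons by (metis prod.collapse)
  next
    assume "\<exists>z. (x, z) \<in> parcs G \<and> (\<exists>p. ?walk z p y \<and> length p = n)"
    then obtain z p where "(x, z) \<in> parcs G" "?walk z p y" "length p = n" by blast
    then show "\<exists>p. ?walk x p y \<and> length p = Suc n"
      by (intro exI[of _ "(x, z) # p"]) (simp add: Cons)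
  qed
  also have "\<dots> \<longleftrightarrow> (\<exists>z. (x, z) \<in> parcs G \<and> (z, y) \<in> parcs G ^^ n)"
    using Suc.IH pair_graphD(3)[OF assms(1)] by blast
  also have "\<dots> \<longleftrightarrow> (x, y) \<in> parcs G ^^ Suc n"
    by (blast intro: relpow_Suc_I2 dest: relpow_Suc_D2)
  finally show ?case .
qed

lemma graph_dist_eq_rel_dist:
  assumes "pair_graph G" "x \<in> pverts G"
  shows "graph_dist G x y = rel_dist (parcs G) x y"
  by (simp add: graph_dist_def rel_dist_def awalk_iff_relpow[OF assms])

lemma connected_on_parcs:
  assumes "pair_graph G" "connected (with_proj G)"
  shows "connected_on (parcs G) (pverts G)" "Restr (parcs G) (pverts G) = parcs G"
proof -
  note wf = pair_graphD(6)[OF assms(1)]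
  show R: "Restr (parcs G) (pverts G) = parcs G"
    using pair_graphD(3)[OF assms(1)] by blast
  have "symmetric (with_proj G)" using pair_graphD(4)[OF assms(1)] by (simp add: symmetric_def)
  then have sc: "strongly_connected (with_proj G)"
    by (rule wf_digraph.symmetric_connected_imp_strongly_connected[OF wf _ assms(2)])
  show "connected_on (parcs G) (pverts G)"
    unfolding connected_on_def R
  proof (intro ballI)
    fix x y assume xy: "x \<in> pverts G" "y \<in> pverts G"
    then have "x \<rightarrow>\<^sup>*\<^bsub>with_proj G\<^esub> y"
      using sc by (auto elim: strongly_connectedE)
    then obtain p where "pre_digraph.awalk (with_proj G) x p y"
      by (auto simp: wf_digraph.reachable_awalk[OF wf])
    then have "(x, y) \<in> parcs G ^^ length p"
      using awalk_iff_relpow[OF assms(1) xy(1)] by blast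
    then show "(x, y) \<in> (parcs G)\<^sup>*" by (rule relpow_imp_rtrancl)
  qed
qed

lemma sym_parcs_path_graph: "sym (parcs (path_graph n))"
  by (auto simp: path_graph_def sym_def)

lemma path_graph_reachable_from_0:
  assumes "k \<le> n"
  shows "(0, k) \<in> (parcs (path_graph n))\<^sup>*"
  using assms
proof (induction k)
  case (Suc k)
  then have "(0, k) \<in> (parcs (path_graph n))\<^sup>*" "(k, Suc k) \<in> parcs (path_graph n)"
    by (simp_all add: path_graph_def)
  then show ?case by (rule rtrancl_into_rtrancl)
qed simp

lemma line_dist_le_path_graph_walk:
  assumes "(i, k) \<in> parcs (path_graph n) ^^ m"
  shows "line_dist i k \<le> m"
  using assms
proof (induction m arbitrary: k)
  case 0
  then show ?case by (simp add: line_dist_def)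
next
  case (Suc m)
  then obtain z where z: "(i, z) \<in> parcs (path_graph n) ^^ m" "(z, k) \<in> parcs (path_graph n)"
    by auto
  have "k = Suc z \<or> z = Suc k" using z(2) by (simp add: path_graph_def)
  with Suc.IH[OF z(1)] show ?case by (auto simp: line_dist_def)
qed

lemma line_dist_le_graph_dist_path_graph:
  assumes "i \<le> n" "j \<le> n"
  shows "line_dist i j \<le> graph_dist (path_graph n) i j"
proof -
  let ?R = "parcs (path_graph n)"
  have "(i, 0) \<in> ?R\<^sup>*"
    using path_graph_reachable_from_0[OF assms(1)] sym_rtrancl[OF sym_parcs_path_graph]
    by (rule symD[rotated])
  then have "(i, j) \<in> ?R\<^sup>*"
    using path_graph_reachable_from_0[OF assms(2)] by (rule rtrancl_trans)
  then have "line_dist i j \<le> rel_dist ?R i j"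
    by (rule line_dist_le_path_graph_walk[OF relpow_rel_dist])
  moreover have "i \<in> pverts (path_graph n)" using assms(1) by (simp add: path_graph_def)
  ultimately show ?thesis
    by (simp add: graph_dist_eq_rel_dist[OF pair_graph_path_graph])
qed

lemma arcs_over_edge:
  fixes R :: "'a rel"
  assumes "(a, b) \<in> R" "(b, a) \<in> R"
  shows "{z \<in> R. (\<lambda>(x, y). {x, y}) z = {a, b}} = {(a, b), (b, a)}"
proof (rule set_eqI)
  fix z :: "'a \<times> 'a"
  obtain x y where z: "z = (x, y)" by (rule prod.exhaust)
  have "z \<in> {z \<in> R. (\<lambda>(x, y). {x, y}) z = {a, b}} \<longleftrightarrow> (x, y) \<in> R \<and> {x, y} = {a, b}"
    by (simp only: z mem_Collect_eq prod.case)
  also have "\<dots> \<longleftrightarrow> (x, y) \<in> R \<and> (x = a \<and> y = b \<or> x = b \<and> y = a)"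
    by (simp only: doubleton_eq_iff)
  also have "\<dots> \<longleftrightarrow> x = a \<and> y = b \<or> x = b \<and> y = a"
    using assms by metis
  also have "\<dots> \<longleftrightarrow> z \<in> {(a, b), (b, a)}"
    by (simp only: z insert_iff prod.inject empty_iff simp_thms)
  finally show "z \<in> {z \<in> R. (\<lambda>(x, y). {x, y}) z = {a, b}} \<longleftrightarrow> z \<in> {(a, b), (b, a)}" .
qed

text \<open>
  Every edge of \<open>H\<close> is the image of two arcs with the same summand.  A sum over arcs can be
  turned into a sum over pairs of vertices, which is the form needed for the induction.
\<close>

lemma sum_parcs_eq_pseudo_sum:
  assumes "pair_graph G" "pair_graph H"
  shows "(\<Sum>(x, y)\<in>parcs H. graph_dist G (f x) (f y)) = 2 * pseudo_sum H f G"
proof -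
  let ?h = "\<lambda>(x, y). graph_dist G (f x) (f y)"
  let ?g = "\<lambda>(x, y). {x, y}"
  have im: "?g ` parcs H = uedges H" by (auto simp: uedges_def)
  have "sum ?h (parcs H) = (\<Sum>e\<in>?g ` parcs H. sum ?h {a \<in> parcs H. ?g a = e})"
    by (rule sum.image_gen) (rule pair_graphD(2)[OF assms(2)])
  also have "\<dots> = (\<Sum>e\<in>uedges H. 2 * the_elem {graph_dist G (f x) (f y) | x y. e = {x, y}})"
    unfolding im
  proof (rule sum.cong[OF refl])
    fix e assume "e \<in> uedges H"
    then obtain a b where e: "e = {a, b}" "(a, b) \<in> parcs H" by (auto simp: uedges_def)
    have ne: "a \<noteq> b" using pair_graphD(5)[OF assms(2) e(2)] .
    have e': "(b, a) \<in> parcs H" using pair_graphD(4)[OF assms(2)] e(2) by (rule symD)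
    have "{x \<in> parcs H. ?g x = e} = {(a, b), (b, a)}"
      unfolding e(1) by (rule arcs_over_edge[OF e(2) e'])
    then have "sum ?h {x \<in> parcs H. ?g x = e} =
        graph_dist G (f a) (f b) + graph_dist G (f b) (f a)"
      using ne by simp
    also have "\<dots> = 2 * graph_dist G (f a) (f b)"
      unfolding graph_dist_sym[OF assms(1), of "f b" "f a"] by simp
    finally have "sum ?h {x \<in> parcs H. ?g x = e} = 2 * graph_dist G (f a) (f b)" .
    then show "sum ?h {x \<in> parcs H. ?g x = e} =
        2 * the_elem {graph_dist G (f x) (f y) | x y. e = {x, y}}"
      by (simp only: e(1) edge_summand[OF assms(1)])
  qed
  finally show ?thesis by (simp add: pseudo_sum_def sum_distrib_left)
qed

lemma sum_parcs_reindex: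
  fixes F :: "'a \<Rightarrow> 'a \<Rightarrow> nat"
  assumes "pair_graph H" "bij_betw f (pverts H) S"
  shows "(\<Sum>(x, y)\<in>parcs H. F (f x) (f y)) =
    (\<Sum>a\<in>S. \<Sum>b\<in>S. of_bool ((a, b) \<in> map_prod f f ` parcs H) * F a b)"
proof -
  have sub: "parcs H \<subseteq> pverts H \<times> pverts H" by (rule pair_graphD(3)[OF assms(1)])
  have inj: "inj_on (map_prod f f) (parcs H)"
    using assms(2) sub by (intro inj_on_subset[OF map_prod_inj_on sub]) (auto simp: bij_betw_def)
  have im: "map_prod f f ` parcs H \<subseteq> S \<times> S"
    using sub assms(2) by (fastforce simp: bij_betw_def)
  have fin: "finite S" using assms(2) pair_graphD(1)[OF assms(1)] bij_betw_finite by blast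
  have "(\<Sum>a\<in>S. \<Sum>b\<in>S. of_bool ((a, b) \<in> map_prod f f ` parcs H) * F a b) =
      (\<Sum>z\<in>S \<times> S. of_bool (z \<in> map_prod f f ` parcs H) * case_prod F z)"
    by (simp add: sum.cartesian_product split_def)
  also have "\<dots> = (\<Sum>z\<in>map_prod f f ` parcs H. case_prod F z)"
    using im fin by (intro sum.mono_neutral_cong_right) auto
  also have "\<dots> = (\<Sum>(x, y)\<in>parcs H. F (f x) (f y))"
    by (subst sum.reindex[OF inj]) (simp add: split_def)
  finally show ?thesis by simp
qed

section \<open>Comparison with the path\<close>

text \<open>
  With outside weight \<open>0\<close> the auxiliary position \<open>0\<close> has no influence, and the vertices occupy the
  positions from \<open>1\<close> on; shifting them down by one gives the vertices of the path.
\<close>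

lemma exists_path_pseudoordering:
  assumes "pair_graph G" "pair_graph H" "connected (with_proj G)" "pverts G \<noteq> {}"
    and f: "pseudoordering H f G"
  shows "\<exists>f'. pseudoordering H f' (path_graph (card (pverts G) - 1)) \<and>
    pseudo_sum H f G \<le> pseudo_sum H f' (path_graph (card (pverts G) - 1))"
proof -
  let ?S = "pverts G"
  let ?P = "path_graph (card ?S - 1)"
  let ?w = "\<lambda>a b. of_bool ((a, b) \<in> map_prod f f ` parcs H) :: nat"
  obtain u where u: "u \<in> ?S" using assms(4) by blast
  have bf: "bij_betw f (pverts H) ?S" using f by (simp add: pseudoordering_def)
  note fin = pair_graphD(1)[OF assms(1)] and symE = pair_graphD(4)[OF assms(1)]
  have card: "0 < card ?S" using assms(4) fin by (simp add: card_gt_0_iff)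
  obtain p where p: "bij_betw p ?S {1..card ?S}"
    and le: "(\<Sum>x\<in>?S. \<Sum>y\<in>?S. ?w x y * rel_dist (parcs G) x y)
      \<le> (\<Sum>x\<in>?S. \<Sum>y\<in>?S. ?w x y * line_dist (p x) (p y))"
    using exists_line_ordering[OF fin symE connected_on_parcs(1)[OF assms(1,3)] u, of ?w "\<lambda>_. 0"]
    unfolding connected_on_parcs(2)[OF assms(1,3)] by auto
  define r where "r x = p x - 1" for x
  have pin: "1 \<le> p x" "p x \<le> card ?S" if "x \<in> ?S" for x
    using p that by (auto simp: bij_betw_def)
  have "bij_betw (\<lambda>k. k - 1) {1..card ?S} {0..card ?S - 1}"
    using card by (intro bij_betwI[where g = Suc]) auto
  from bij_betw_trans[OF p this] have r: "bij_betw r ?S (pverts ?P)"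
    by (simp add: path_graph_def comp_def r_def[abs_def])
  have dist: "line_dist (p x) (p y) \<le> graph_dist ?P (r x) (r y)" if "x \<in> ?S" "y \<in> ?S" for x y
  proof -
    have "line_dist (p x) (p y) = line_dist (r x) (r y)"
      using pin(1)[OF that(1)] pin(1)[OF that(2)] by (simp add: line_dist_def r_def)
    also have "\<dots> \<le> graph_dist ?P (r x) (r y)"
      using pin(2)[OF that(1)] pin(2)[OF that(2)]
      by (intro line_dist_le_graph_dist_path_graph) (auto simp: r_def)
    finally show ?thesis .
  qed
  have "2 * pseudo_sum H f G = (\<Sum>x\<in>?S. \<Sum>y\<in>?S. ?w x y * graph_dist G x y)"
    unfolding sum_parcs_eq_pseudo_sum[OF assms(1,2), symmetric]
    by (rule sum_parcs_reindex[OF assms(2) bf])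
  also have "\<dots> = (\<Sum>x\<in>?S. \<Sum>y\<in>?S. ?w x y * rel_dist (parcs G) x y)"
    by (simp add: graph_dist_eq_rel_dist[OF assms(1)])
  also have "\<dots> \<le> (\<Sum>x\<in>?S. \<Sum>y\<in>?S. ?w x y * line_dist (p x) (p y))"
    by (rule le)
  also have "(\<Sum>x\<in>?S. \<Sum>y\<in>?S. ?w x y * line_dist (p x) (p y))
      \<le> (\<Sum>x\<in>?S. \<Sum>y\<in>?S. ?w x y * graph_dist ?P (r x) (r y))"
    using dist by (intro sum_mono mult_le_mono2)
  also have "\<dots> = 2 * pseudo_sum H (r \<circ> f) ?P"
    unfolding sum_parcs_eq_pseudo_sum[OF pair_graph_path_graph assms(2), symmetric] comp_apply
    by (rule sum_parcs_reindex[OF assms(2) bf, of "\<lambda>x y. graph_dist ?P (r x) (r y)", symmetric])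
  finally have "pseudo_sum H f G \<le> pseudo_sum H (r \<circ> f) ?P" by simp
  moreover have "pseudoordering H (r \<circ> f) ?P"
    using bij_betw_trans[OF bf r] by (simp add: pseudoordering_def)
  ultimately show ?thesis by blast
qed

theorem corollary2p19:
  fixes G :: "'a pair_pre_digraph" and H :: "'b pair_pre_digraph"
  assumes "pair_graph G" and "pair_graph H"
    and "connected (with_proj G)"
    and "card (pverts G) = card (pverts H)" and "card (pverts G) \<ge> 2"
  shows "upper_hamiltonian_number H G
    \<le> upper_hamiltonian_number H (path_graph (card (pverts G) - 1))"
proof -
  let ?P = "path_graph (card (pverts G) - 1)"
  have ne: "pverts G \<noteq> {}" using assms(5) by auto
  have card: "card (pverts ?P) = card (pverts H)"
    using assms(4,5) by (simp add: card_path_graph)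
  note finP = pseudo_sums_finite_nonempty(1)[OF pair_graph_path_graph assms(2) card]
  show ?thesis
    unfolding upper_hamiltonian_number_def
  proof (subst Max_le_iff[OF pseudo_sums_finite_nonempty[OF assms(1,2,4)]], intro ballI)
    fix s assume "s \<in> {pseudo_sum H f G | f. pseudoordering H f G}"
    then obtain f where "s = pseudo_sum H f G" "pseudoordering H f G" by blast
    with exists_path_pseudoordering[OF assms(1-3) ne] obtain f' where
      "pseudoordering H f' ?P" "s \<le> pseudo_sum H f' ?P" by blast
    then show "s \<le> Max {pseudo_sum H f ?P | f. pseudoordering H f ?P}"
      by (intro order_trans[OF _ Max_ge[OF finP]]) blast+
  qed
qed

end
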